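(* Consider kinetic coupling conditions, i.e. maps $$\Psi\colon L^1_\mu((-\infty,0)_\xi,[0,\infty))^d\to L^1_\mu((0,\infty)_\xi,[0,\infty))^d,\quad g\mapsto\Psi[g],$$ which conserve mass and energy, $$\sum_{k=1}^dA_k\left(\int_0^\infty\xi\,\Psi^k[g](\xi)\,\mathrm{d}\xi+\int_{-\infty}^0\xi\,g^k(\xi)\,\mathrm{d}\xi\right)=0,\qquad \sum_{k=1}^dA_k\left(\int_0^\infty\xi^3\,\Psi^k[g](\xi)\,\mathrm{d}\xi+\int_{-\infty}^0\xi^3\,g^k(\xi)\,\mathrm{d}\xi\right)=0.$$ The unique minimizer of $$\sum_{k=1}^dA_k\int_0^\infty\xi\,\Psi^k[g](\xi)\log\Psi^k[g](\xi)\,\mathrm{d}\xi$$ subject to these two constraints is given by $$\Psi^k[g](\xi)=M_{\rho_*,0,\theta_*}(\xi)\quad\text{for }\xi>0,\ k=1,\dots,d,$$ where $\rho_*\ge0$, $\theta_*>0$ are chosen such that the two conservation conditions hold. For every $g$ there exist such $(\rho_*,0,\theta_* )$.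
   Context: Let $d\in\mathbb N$ and $A_1,\dots,A_d>0$ (cross-sectional areas of $d$ pipelines meeting at a junction). For $\rho\ge0$, $u\in\mathbb R$, $\theta>0$ the standard Maxwellian is $$M_{\rho,u,\theta}(\xi)=\frac{\rho}{\sqrt{2\pi\theta}}\exp\left(\frac{-(u-\xi)^2}{2\theta}\right),\quad\xi\in\mathbb R.$$ The vector $g=(g^1,\dots,g^d)$ represents the kinetic data arriving at the junction (velocities $\xi<0$) and $\Psi[g]=(\Psi^1[g],\dots,\Psi^d[g])$ the data leaving it (velocities $\xi>0$). $L^1_\mu(I,[0,\infty))$ denotes the $[0,\infty)$-valued functions on $I\subset\mathbb R$ integrable with respect to a measure $\mu$ in the variable $\xi$; the source does not specify $\mu$ further. The function $v\mapsto v\log v$ is considered on $[0,\infty)$ (with value $0$ at $v=0$). *)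

theory Defs
  imports "HOL-Probability.Probability"
begin

definition maxwellian :: "real \<Rightarrow> real \<Rightarrow> real \<Rightarrow> real \<Rightarrow> real" where
  "maxwellian \<rho> u \<theta> \<xi> = \<rho> / sqrt (2 * pi * \<theta>) * exp (- ((u - \<xi>)\<^sup>2) / (2 * \<theta>))"

text \<open>
  Requirements on the otherwise arbitrary measure of the spaces \<open>L\<^sup>1\<^sub>\<mu>\<close>: equality almost everywhere
  means the same for \<open>\<mu>\<close> and for the Lebesgue measure, the mass and energy fluxes of every
  \<open>\<mu>\<close>-integrable function are finite, and the centred Maxwellians restricted to positive
  velocities belong to \<open>L\<^sup>1\<^sub>\<mu>\<close>.
\<close>

definition kinetic_measure :: "real measure \<Rightarrow> bool" where
  "kinetic_measure \<mu> \<longleftrightarrow>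
     sets \<mu> = sets borel \<and>
     null_sets \<mu> = null_sets lborel \<and>
     (\<forall>f :: real \<Rightarrow> real. integrable \<mu> f \<longrightarrow>
        integrable lborel (\<lambda>\<xi>. \<xi> * f \<xi>) \<and> integrable lborel (\<lambda>\<xi>. \<xi> ^ 3 * f \<xi>)) \<and>
     (\<forall>\<rho> \<theta>. 0 \<le> \<rho> \<longrightarrow> 0 < \<theta> \<longrightarrow> set_integrable \<mu> {0<..} (maxwellian \<rho> 0 \<theta>))"

text \<open>The largest such space consists of the functions with finite mass and energy fluxes.\<close>

lemma kinetic_measure_flux_density:
  "kinetic_measure (density lborel (\<lambda>\<xi>. ennreal (\<bar>\<xi>\<bar> + \<bar>\<xi>\<bar> ^ 3)))"
proof -
  let ?w = "\<lambda>\<xi>::real. \<bar>\<xi>\<bar> + \<bar>\<xi>\<bar> ^ 3"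
  let ?M = "density lborel (\<lambda>\<xi>. ennreal (?w \<xi>))"
  have z: "{0::real} \<in> null_sets lborel" by (simp add: null_sets_def)
  have pos: "?w x > 0" if "x \<noteq> 0" for x using that by (simp add: add_pos_pos)
  have nn: "?w x \<ge> 0" for x by simp
  have "null_sets ?M = null_sets lborel"
  proof (rule set_eqI)
    fix N
    have "AE x in lborel. x \<noteq> (0::real)" using z by (simp add: AE_lborel_singleton)
    then have "(AE x in lborel. x \<in> N \<longrightarrow> ennreal (?w x) = 0) \<longleftrightarrow> (AE x in lborel. x \<notin> N)"
      using pos by (intro iffI; elim AE_mp) (auto intro!: AE_I2 simp: ennreal_eq_0_iff less_le_not_le)
    moreover have "N \<in> null_sets ?M \<longleftrightarrow> N \<in> sets lborel \<and> (AE x in lborel. x \<in> N \<longrightarrow> ennreal (?w x) = 0)"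
      by (subst null_sets_density_iff) auto
    moreover have "N \<in> null_sets lborel \<longleftrightarrow> N \<in> sets lborel \<and> (AE x in lborel. x \<notin> N)"
      using AE_iff_null_sets[of N "lborel :: real measure"] null_setsD2[of N lborel] by blast
    ultimately show "N \<in> null_sets ?M \<longleftrightarrow> N \<in> null_sets lborel"
      by blast
  qed
  moreover have "integrable lborel (\<lambda>\<xi>. \<xi> * f \<xi>) \<and> integrable lborel (\<lambda>\<xi>. \<xi> ^ 3 * f \<xi>)"
    if "integrable ?M f" for f :: "real \<Rightarrow> real"
  proof -
    have m: "f \<in> borel_measurable borel" using borel_measurable_integrable[OF that] by simp
    then have i: "integrable lborel (\<lambda>x. ?w x * f x)"
      using that by (subst (asm) integrable_density) auto
    have 1: "integrable lborel (\<lambda>\<xi>. \<xi> * f \<xi>)"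
      by (rule Bochner_Integration.integrable_bound[OF i]) (use m in \<open>auto simp: abs_mult intro!: AE_I2 mult_right_mono\<close>)
    have 2: "integrable lborel (\<lambda>\<xi>. \<xi>^3 * f \<xi>)"
      by (rule Bochner_Integration.integrable_bound[OF i]) (use m in \<open>auto simp: abs_mult power_abs intro!: AE_I2 mult_right_mono\<close>)
    show ?thesis using 1 2 by simp
  qed
  moreover have "set_integrable ?M {0<..} (maxwellian \<rho> 0 \<theta>)" if "0 < \<theta>" for \<rho> \<theta>
  proof -
    have e: "maxwellian \<rho> 0 \<theta> = (\<lambda>x. \<rho> * normal_density 0 (sqrt \<theta>) x)"
      using that by (auto simp: maxwellian_def normal_density_def fun_eq_iff)
    have s: "sqrt \<theta> > 0" using that by simp
    have "integrable lborel (\<lambda>x. normal_density 0 (sqrt \<theta>) x * \<bar>x - 0\<bar>^1)"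
      "integrable lborel (\<lambda>x. normal_density 0 (sqrt \<theta>) x * \<bar>x - 0\<bar>^3)"
      by (rule integrable_normal_moment_abs[OF s])+
    then have "integrable lborel (\<lambda>x. \<rho> * (normal_density 0 (sqrt \<theta>) x * \<bar>x\<bar> + normal_density 0 (sqrt \<theta>) x * \<bar>x\<bar>^3))"
      by (intro integrable_mult_right Bochner_Integration.integrable_add) simp_all
    then have "integrable lborel (\<lambda>x. ?w x * maxwellian \<rho> 0 \<theta> x)" unfolding e by (simp add: algebra_simps)
    then have "integrable ?M (maxwellian \<rho> 0 \<theta>)"
      by (subst integrable_density) (auto simp: maxwellian_def[abs_def])
    then have "set_integrable ?M UNIV (maxwellian \<rho> 0 \<theta>)" by (simp add: set_integrable_def)
    then show ?thesis by (rule set_integrable_subset) auto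
  qed
  ultimately show ?thesis by (auto simp: kinetic_measure_def)
qed

text \<open>
  Elements of \<open>L\<^sup>1\<^sub>\<mu>(I, [0,\<infinity>))\<close> are represented by functions on the whole line whose values outside
  \<open>I\<close> are irrelevant; \<open>d\<close>-tuples are functions on \<^term>\<open>{1..d}\<close>, extended arbitrarily.
\<close>

definition L1_nonneg :: "real measure \<Rightarrow> real set \<Rightarrow> (real \<Rightarrow> real) set" where
  "L1_nonneg \<mu> I = {f. set_integrable \<mu> I f \<and> (\<forall>\<xi>\<in>I. 0 \<le> f \<xi>)}"

definition L1_tuple :: "real measure \<Rightarrow> nat \<Rightarrow> real set \<Rightarrow> (nat \<Rightarrow> real \<Rightarrow> real) set" where
  "L1_tuple \<mu> d I = {1..d} \<rightarrow> L1_nonneg \<mu> I"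

definition ae_eq_tuple ::
  "real measure \<Rightarrow> nat \<Rightarrow> real set \<Rightarrow> (nat \<Rightarrow> real \<Rightarrow> real) \<Rightarrow> (nat \<Rightarrow> real \<Rightarrow> real) \<Rightarrow> bool" where
  "ae_eq_tuple \<mu> d I g h \<longleftrightarrow> (\<forall>k\<in>{1..d}. AE \<xi> in \<mu>. \<xi> \<in> I \<longrightarrow> g k \<xi> = h k \<xi>)"

text \<open>Here \<open>g\<close> is the data arriving at the junction and \<open>h\<close> the data leaving it.\<close>

definition conserves_mass ::
  "nat \<Rightarrow> (nat \<Rightarrow> real) \<Rightarrow> (nat \<Rightarrow> real \<Rightarrow> real) \<Rightarrow> (nat \<Rightarrow> real \<Rightarrow> real) \<Rightarrow> bool" where
  "conserves_mass d A g h \<longleftrightarrow>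
     (\<Sum>k=1..d. A k * ((LBINT \<xi>:{0<..}. \<xi> * h k \<xi>) + (LBINT \<xi>:{..<0}. \<xi> * g k \<xi>))) = 0"

definition conserves_energy ::
  "nat \<Rightarrow> (nat \<Rightarrow> real) \<Rightarrow> (nat \<Rightarrow> real \<Rightarrow> real) \<Rightarrow> (nat \<Rightarrow> real \<Rightarrow> real) \<Rightarrow> bool" where
  "conserves_energy d A g h \<longleftrightarrow>
     (\<Sum>k=1..d. A k * ((LBINT \<xi>:{0<..}. \<xi> ^ 3 * h k \<xi>) + (LBINT \<xi>:{..<0}. \<xi> ^ 3 * g k \<xi>))) = 0"

text \<open>
  Coupling conditions are maps between spaces of equivalence classes, hence the compatibility with
  equality almost everywhere.
\<close>

definition kinetic_coupling ::
  "real measure \<Rightarrow> nat \<Rightarrow> (nat \<Rightarrow> real) \<Rightarrow>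
   ((nat \<Rightarrow> real \<Rightarrow> real) \<Rightarrow> (nat \<Rightarrow> real \<Rightarrow> real)) \<Rightarrow> bool" where
  "kinetic_coupling \<mu> d A \<Psi> \<longleftrightarrow>
     \<Psi> \<in> L1_tuple \<mu> d {..<0} \<rightarrow> L1_tuple \<mu> d {0<..} \<and>
     (\<forall>g\<in>L1_tuple \<mu> d {..<0}. \<forall>g'\<in>L1_tuple \<mu> d {..<0}.
        ae_eq_tuple \<mu> d {..<0} g g' \<longrightarrow> ae_eq_tuple \<mu> d {0<..} (\<Psi> g) (\<Psi> g')) \<and>
     (\<forall>g\<in>L1_tuple \<mu> d {..<0}. conserves_mass d A g (\<Psi> g) \<and> conserves_energy d A g (\<Psi> g))"

text \<open>
  The entropy flux of an admissible \<open>h\<close> may be \<open>+\<infinity>\<close>, and the Bochner integral would then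
  take the value \<open>0\<close>; so the integral is taken in the extended reals, as the difference of the
  integrals of the positive and the negative part (the latter is finite whenever the mass and
  energy fluxes of \<open>h\<close> are).
\<close>

definition extended_integral :: "'a measure \<Rightarrow> 'a set \<Rightarrow> ('a \<Rightarrow> real) \<Rightarrow> ereal" where
  "extended_integral M I f =
     enn2ereal (\<integral>\<^sup>+x\<in>I. ennreal (f x) \<partial>M) - enn2ereal (\<integral>\<^sup>+x\<in>I. ennreal (- f x) \<partial>M)"

definition entropy_flux :: "nat \<Rightarrow> (nat \<Rightarrow> real) \<Rightarrow> (nat \<Rightarrow> real \<Rightarrow> real) \<Rightarrow> ereal" where
  "entropy_flux d A h =
     (\<Sum>k=1..d. ereal (A k) * extended_integral lborel {0<..} (\<lambda>\<xi>. \<xi> * (h k \<xi> * ln (h k \<xi>))))"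

definition entropy_minimizer_at ::
  "real measure \<Rightarrow> nat \<Rightarrow> (nat \<Rightarrow> real) \<Rightarrow> (nat \<Rightarrow> real \<Rightarrow> real) \<Rightarrow>
   ((nat \<Rightarrow> real \<Rightarrow> real) \<Rightarrow> (nat \<Rightarrow> real \<Rightarrow> real)) \<Rightarrow> bool" where
  "entropy_minimizer_at \<mu> d A g \<Psi> \<longleftrightarrow>
     kinetic_coupling \<mu> d A \<Psi> \<and>
     (\<forall>\<Phi>. kinetic_coupling \<mu> d A \<Phi> \<longrightarrow> entropy_flux d A (\<Psi> g) \<le> entropy_flux d A (\<Phi> g))"

definition unique_entropy_minimizer ::
  "real measure \<Rightarrow> nat \<Rightarrow> (nat \<Rightarrow> real) \<Rightarrow>
   ((nat \<Rightarrow> real \<Rightarrow> real) \<Rightarrow> (nat \<Rightarrow> real \<Rightarrow> real)) \<Rightarrow> bool" where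
  "unique_entropy_minimizer \<mu> d A \<Psi> \<longleftrightarrow>
     (\<forall>g\<in>L1_tuple \<mu> d {..<0}.
        entropy_minimizer_at \<mu> d A g \<Psi> \<and>
        (\<forall>\<Phi>. entropy_minimizer_at \<mu> d A g \<Phi> \<longrightarrow> ae_eq_tuple \<mu> d {0<..} (\<Phi> g) (\<Psi> g)))"

definition maxwellian_parameters ::
  "nat \<Rightarrow> (nat \<Rightarrow> real) \<Rightarrow> (nat \<Rightarrow> real \<Rightarrow> real) \<Rightarrow> real \<Rightarrow> real \<Rightarrow> bool" where
  "maxwellian_parameters d A g \<rho> \<theta> \<longleftrightarrow>
     0 \<le> \<rho> \<and> 0 < \<theta> \<and>
     conserves_mass d A g (\<lambda>k. maxwellian \<rho> 0 \<theta>) \<and>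
     conserves_energy d A g (\<lambda>k. maxwellian \<rho> 0 \<theta>)"

end

(* Gibbs' inequality h ln h >= h ln M + h - M, strict unless h = M, bounds the entropy flux of
   outgoing data h from below. As ln M is affine in xi^2 for a centred Maxwellian M, the integral
   of the right-hand side against xi depends on h only through its mass and energy fluxes, which
   the conservation laws prescribe. Hence M is the unique minimiser. The mass flux of M is
   rho sqrt (theta / (2 pi)) and its energy flux is 2 theta times this, which determines theta
   and rho as soon as the incoming mass flux does not vanish; otherwise rho = 0. *)
theory Submission imports Defs begin

section \<open>Odd moments of the centred Maxwellian on the half-line\<close>

lemma maxwellian_nonneg: "0 \<le> \<rho> \<Longrightarrow> 0 < \<theta> \<Longrightarrow> 0 \<le> maxwellian \<rho> u \<theta> \<xi>"
  by (simp add: maxwellian_def)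

lemma maxwellian_pos: "0 < \<rho> \<Longrightarrow> 0 < \<theta> \<Longrightarrow> 0 < maxwellian \<rho> u \<theta> \<xi>"
  by (simp add: maxwellian_def)

lemma maxwellian_0 [simp]: "maxwellian 0 u \<theta> \<xi> = 0"
  by (simp add: maxwellian_def)

lemma ln_maxwellian:
  assumes "0 < \<rho>" "0 < \<theta>"
  shows "ln (maxwellian \<rho> u \<theta> \<xi>) = ln (\<rho> / sqrt (2 * pi * \<theta>)) - (u - \<xi>)\<^sup>2 / (2 * \<theta>)"
proof -
  have "0 < \<rho> / sqrt (2 * pi * \<theta>)" using assms by simp
  then show ?thesis unfolding maxwellian_def by (subst ln_mult) auto
qed

text \<open>Rescaling by \<open>s = sqrt (2 * \<theta>)\<close> reduces the moment to the Gaussian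
  one, the integral of \<open>x ^ (2 * n + 1) * exp (- x\<^sup>2)\<close> over the positive
  half-line, which is \<open>fact n / 2\<close>. The cases \<open>n = 0\<close> and
  \<open>n = 1\<close> are the mass and the energy flux.\<close>

lemma maxwellian_odd_moment:
  assumes "0 < \<theta>"
  shows "set_integrable lborel {0<..} (\<lambda>\<xi>. \<xi> ^ (2 * n + 1) * maxwellian \<rho> 0 \<theta> \<xi>)" (is ?int)
    and "(LBINT \<xi>:{0<..}. \<xi> ^ (2 * n + 1) * maxwellian \<rho> 0 \<theta> \<xi>)
           = \<rho> * sqrt (\<theta> / (2 * pi)) * (2 * \<theta>) ^ n * fact n" (is ?eq)
proof -
  define s where "s = sqrt (2 * \<theta>)"
  have s: "0 < s" "s\<^sup>2 = 2 * \<theta>" using assms by (auto simp: s_def)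
  define C where "C = \<rho> / sqrt (2 * pi * \<theta>) * s ^ (2 * n + 1)"
  have "has_bochner_integral lborel
          (\<lambda>x::real. indicator {0..} (0 + (1/s) * x) *\<^sub>R
             (exp (- (0 + (1/s) * x)\<^sup>2) * (0 + (1/s) * x) ^ (2 * n + 1)))
          ((fact n / 2) /\<^sub>R \<bar>1/s\<bar>)"
    using s by (intro lborel_has_bochner_integral_real_affine_iff[THEN iffD1, OF _ gaussian_moment_odd_pos])
      auto
  then have "has_bochner_integral lborel
          (\<lambda>x::real. C * (indicator {0..} (0 + (1/s) * x) *\<^sub>R
             (exp (- (0 + (1/s) * x)\<^sup>2) * (0 + (1/s) * x) ^ (2 * n + 1))))
          (C * ((fact n / 2) /\<^sub>R \<bar>1/s\<bar>))"
    by (rule has_bochner_integral_mult_right)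
  \<comment> \<open>The indicators of \<open>{0..}\<close> and \<open>{0<..}\<close> differ only at
    0, where the odd power vanishes, so the functions agree everywhere and not just almost
    everywhere.\<close>
  also have "(\<lambda>x::real. C * (indicator {0..} (0 + (1/s) * x) *\<^sub>R
             (exp (- (0 + (1/s) * x)\<^sup>2) * (0 + (1/s) * x) ^ (2 * n + 1))))
        = (\<lambda>x. indicator {0<..} x *\<^sub>R (x ^ (2 * n + 1) * maxwellian \<rho> 0 \<theta> x))"
  proof
    fix x :: real
    have "(x / s)\<^sup>2 = x\<^sup>2 / (2 * \<theta>)" using s by (simp add: power_divide)
    then show "C * (indicator {0..} (0 + (1/s) * x) *\<^sub>R
             (exp (- (0 + (1/s) * x)\<^sup>2) * (0 + (1/s) * x) ^ (2 * n + 1)))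
        = indicator {0<..} x *\<^sub>R (x ^ (2 * n + 1) * maxwellian \<rho> 0 \<theta> x)"
      using s(1) by (cases x "0::real" rule: linorder_cases)
        (simp_all add: C_def maxwellian_def zero_le_divide_iff power_divide)
  qed
  also have "C * ((fact n / 2) /\<^sub>R \<bar>1/s\<bar>) = \<rho> * sqrt (\<theta> / (2 * pi)) * (2 * \<theta>) ^ n * fact n"
  proof -
    \<comment> \<open>The Jacobian contributes one more factor \<open>s\<close>, which makes the
      exponent even and removes the square root. Half of the extra \<open>2 * \<theta>\<close> then
      merges with the prefactor into \<open>sqrt (\<theta> / (2 * pi))\<close>.\<close>
    have "s ^ (2 * n + 1) * s = (2 * \<theta>) ^ n * (2 * \<theta>)"
      using s(2) by (simp add: power_mult power2_eq_square)
    moreover have q: "\<theta> / sqrt (2 * pi * \<theta>) = sqrt (\<theta> / (2 * pi))"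
      using assms by (simp add: real_sqrt_mult real_sqrt_divide field_simps)
    moreover have "C * ((fact n / 2) /\<^sub>R \<bar>1/s\<bar>)
        = \<rho> / sqrt (2 * pi * \<theta>) * (s ^ (2 * n + 1) * s) * (fact n / 2)"
      using s(1) by (simp add: C_def)
    ultimately have "C * ((fact n / 2) /\<^sub>R \<bar>1/s\<bar>)
        = \<rho> / sqrt (2 * pi * \<theta>) * ((2 * \<theta>) ^ n * (2 * \<theta>)) * (fact n / 2)"
      by (simp only:)
    also have "\<dots> = \<rho> * (\<theta> / sqrt (2 * pi * \<theta>)) * (2 * \<theta>) ^ n * fact n" by simp
    finally show ?thesis unfolding q .
  qed
  finally show ?int ?eq
    by (auto simp: set_integrable_def set_lebesgue_integral_def has_bochner_integral_iff)
qed

lemma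
  assumes "0 < \<theta>"
  shows maxwellian_mass_integrable: "set_integrable lborel {0<..} (\<lambda>\<xi>. \<xi> * maxwellian \<rho> 0 \<theta> \<xi>)"
    and maxwellian_mass: "(LBINT \<xi>:{0<..}. \<xi> * maxwellian \<rho> 0 \<theta> \<xi>) = \<rho> * sqrt (\<theta> / (2 * pi))"
    and maxwellian_energy_integrable:
      "set_integrable lborel {0<..} (\<lambda>\<xi>. \<xi> ^ 3 * maxwellian \<rho> 0 \<theta> \<xi>)"
    and maxwellian_energy:
      "(LBINT \<xi>:{0<..}. \<xi> ^ 3 * maxwellian \<rho> 0 \<theta> \<xi>) = \<rho> * sqrt (\<theta> / (2 * pi)) * (2 * \<theta>)"
  using maxwellian_odd_moment[OF assms, of 0 \<rho>] maxwellian_odd_moment[OF assms, of 1 \<rho>] by simp_all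

section \<open>Gibbs' inequality, extended integrals and relative entropy\<close>

text \<open>For positive \<open>x\<close> the gap between the two sides is
  \<open>x * (t - 1 - ln t)\<close> with \<open>t = m / x\<close>, and
  \<open>ln t \<le> t - 1\<close> is an equality only at \<open>t = 1\<close>. At
  \<open>x = 0\<close> the factor \<open>x\<close> kills the logarithm and the gap is
  \<open>m > 0\<close>.\<close>

lemma gibbs_pointwise:
  fixes x m :: real
  assumes "0 \<le> x" "0 < m"
  shows "x * ln m + x - m \<le> x * ln x"
    and "x * ln x = x * ln m + x - m \<longleftrightarrow> x = m"
proof -
  have *: "x * ln m + x - m \<le> x * ln x \<and> (x * ln x = x * ln m + x - m \<longleftrightarrow> x = m)"
  proof (cases "x = 0")
    case False
    then have x: "0 < x" using assms by simp
    have l: "ln (m / x) = ln m - ln x" using x assms by (simp add: ln_div)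
    have eq: "x * ln x - (x * ln m + x - m) = x * (m / x - 1 - ln (m / x))"
      unfolding l using x by (simp add: field_simps)
    have "ln (m / x) \<le> m / x - 1" using x assms by (intro ln_le_minus_one) simp
    then have le: "0 \<le> x * (m / x - 1 - ln (m / x))" using x by simp
    have "x = m" if "x * ln x = x * ln m + x - m"
    proof -
      have "ln (m / x) = m / x - 1" using eq that x by simp
      then have "m / x = 1" using x assms by (intro ln_eq_minus_one) simp_all
      then show ?thesis using x by simp
    qed
    with eq le show ?thesis by auto
  qed (use assms in auto)
  then show "x * ln m + x - m \<le> x * ln x" "x * ln x = x * ln m + x - m \<longleftrightarrow> x = m" by auto
qed

text \<open>The negative part of \<open>f\<close> is dominated by the absolute value of the
  integrable minorant \<open>l\<close>, so its integral is finite and the difference is never of the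
  form \<infinity> - \<infinity>. For the entropy density, Gibbs' inequality supplies
  \<open>l\<close>.\<close>

lemma extended_integral_lower_bounded:
  assumes f: "set_borel_measurable M I f" and l: "set_integrable M I l"
    and le: "\<And>x. x \<in> I \<Longrightarrow> l x \<le> f x"
  shows "extended_integral M I f =
    (if set_integrable M I f then ereal (LINT x:I|M. f x) else \<infinity>)"
proof -
  let ?F = "\<lambda>x. indicator I x *\<^sub>R f x"
  let ?L = "\<lambda>x. indicator I x *\<^sub>R l x"
  have F: "?F \<in> borel_measurable M" using f by (simp add: set_borel_measurable_def)
  have pos: "(\<integral>\<^sup>+x\<in>I. ennreal (f x) \<partial>M) = (\<integral>\<^sup>+x. ennreal (?F x) \<partial>M)"
    and neg: "(\<integral>\<^sup>+x\<in>I. ennreal (- f x) \<partial>M) = (\<integral>\<^sup>+x. ennreal (- ?F x) \<partial>M)"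
    by (auto intro!: nn_integral_cong simp: indicator_def)
  have "(\<integral>\<^sup>+x. ennreal (- ?F x) \<partial>M) \<le> (\<integral>\<^sup>+x. ennreal (norm (?L x)) \<partial>M)"
    using le by (intro nn_integral_mono ennreal_leI) (force simp: indicator_def)
  also have "\<dots> < \<infinity>" using l by (simp add: set_integrable_def integrable_iff_bounded)
  finally have fin: "(\<integral>\<^sup>+x. ennreal (- ?F x) \<partial>M) < \<infinity>" .
  show ?thesis
  proof (cases "(\<integral>\<^sup>+x. ennreal (?F x) \<partial>M) = \<infinity>")
    case True
    then have "extended_integral M I f = \<infinity>"
      using fin unfolding extended_integral_def pos neg
      by (cases "\<integral>\<^sup>+x. ennreal (- ?F x) \<partial>M") (auto simp: enn2ereal_ennreal)
    moreover have "\<not> set_integrable M I f"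
      using True by (auto simp: set_integrable_def real_integrable_def)
    ultimately show ?thesis by simp
  next
    case False
    with F fin have i: "integrable M ?F" by (auto simp: real_integrable_def)
    have "extended_integral M I f = ereal (integral\<^sup>L M ?F)"
      unfolding extended_integral_def pos neg real_lebesgue_integral_def[OF i]
      using fin False
      by (cases "\<integral>\<^sup>+x. ennreal (- ?F x) \<partial>M"; cases "\<integral>\<^sup>+x. ennreal (?F x) \<partial>M")
        (auto simp: enn2ereal_ennreal)
    with i show ?thesis by (simp add: set_integrable_def set_lebesgue_integral_def)
  qed
qed

lemma extended_integral_cong_AE:
  assumes "AE x in M. x \<in> I \<longrightarrow> f x = g x"
  shows "extended_integral M I f = extended_integral M I g"
  unfolding extended_integral_def using assms
  by (intro arg_cong2[where f = "(-)"] arg_cong[where f = enn2ereal] nn_integral_cong_AE; elim AE_mp)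
    (auto intro!: AE_I2 simp: indicator_def)

lemma set_integral_nonneg_eq_0_AE:
  fixes f :: "'a \<Rightarrow> real"
  assumes "set_integrable M I f" "\<And>x. x \<in> I \<Longrightarrow> 0 \<le> f x" "(LINT x:I|M. f x) = 0"
  shows "AE x in M. x \<in> I \<longrightarrow> f x = 0"
proof -
  have "AE x in M. indicator I x *\<^sub>R f x = 0"
    using assms unfolding set_integrable_def set_lebesgue_integral_def
    by (subst integral_nonneg_eq_0_iff_AE[symmetric]) (auto simp: indicator_def)
  then show ?thesis by (elim AE_mp) (auto intro!: AE_I2)
qed

text \<open>Since no \<open>E k\<close> equals -\<infinity>, a single infinite term makes the whole
  sum infinite. The weights must be strictly positive because 0 * \<infinity> is 0 in
  \<open>ereal\<close>.\<close>

lemma sum_ereal_finite_or_infinite: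
  fixes c :: "'a \<Rightarrow> real" and E :: "'a \<Rightarrow> ereal"
  assumes "finite K" "\<And>k. k \<in> K \<Longrightarrow> 0 < c k"
    and "\<And>k. k \<in> K \<Longrightarrow> E k = \<infinity> \<or> E k = ereal (e k)"
  shows "(\<Sum>k\<in>K. ereal (c k) * E k) = \<infinity> \<or>
    (\<forall>k\<in>K. E k = ereal (e k)) \<and> (\<Sum>k\<in>K. ereal (c k) * E k) = ereal (\<Sum>k\<in>K. c k * e k)"
proof (cases "\<exists>k\<in>K. E k = \<infinity>")
  case True
  then obtain k where "k \<in> K" "E k = \<infinity>" by blast
  then have "ereal (c k) * E k = \<infinity>" using assms(2)[of k] by auto
  with \<open>k \<in> K\<close> assms(1) show ?thesis by (auto simp: sum_Pinfty)
next
  case False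
  then have "\<forall>k\<in>K. E k = ereal (e k)" using assms(3) by blast
  then show ?thesis by simp
qed

text \<open>Serves two purposes: outgoing data of zero mass flux vanish almost everywhere, and the
  incoming mass flux is zero exactly if the incoming energy flux is, both meaning that the data
  vanish.\<close>

lemma sum_weighted_integrals_nonneg:
  fixes f :: "nat \<Rightarrow> real \<Rightarrow> real" and w :: "real \<Rightarrow> real"
  assumes A: "\<And>k. k \<in> {1..d} \<Longrightarrow> 0 < A k"
    and int: "\<And>k. k \<in> {1..d} \<Longrightarrow> set_integrable M I (\<lambda>\<xi>. w \<xi> * f k \<xi>)"
    and nn: "\<And>k \<xi>. k \<in> {1..d} \<Longrightarrow> \<xi> \<in> I \<Longrightarrow> 0 \<le> f k \<xi>"
    and w: "\<And>\<xi>. \<xi> \<in> I \<Longrightarrow> 0 < w \<xi>"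
  shows "0 \<le> (\<Sum>k=1..d. A k * (LINT \<xi>:I|M. w \<xi> * f k \<xi>))"
    and "(\<Sum>k=1..d. A k * (LINT \<xi>:I|M. w \<xi> * f k \<xi>)) = 0 \<longleftrightarrow>
      (\<forall>k\<in>{1..d}. AE \<xi> in M. \<xi> \<in> I \<longrightarrow> f k \<xi> = 0)"
proof -
  have wf: "0 \<le> w \<xi> * f k \<xi>" if "k \<in> {1..d}" "\<xi> \<in> I" for k \<xi>
    using nn[OF that] w[OF that(2)] by simp
  have I_nn: "0 \<le> A k * (LINT \<xi>:I|M. w \<xi> * f k \<xi>)" if "k \<in> {1..d}" for k
    unfolding set_lebesgue_integral_def using A[OF that] wf[OF that]
    by (intro mult_nonneg_nonneg integral_nonneg_AE AE_I2) (auto simp: indicator_def)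
  have I_0: "(LINT \<xi>:I|M. w \<xi> * f k \<xi>) = 0 \<longleftrightarrow> (AE \<xi> in M. \<xi> \<in> I \<longrightarrow> f k \<xi> = 0)"
    if k: "k \<in> {1..d}" for k
  proof
    assume "(LINT \<xi>:I|M. w \<xi> * f k \<xi>) = 0"
    with int[OF k] wf[OF k] have "AE \<xi> in M. \<xi> \<in> I \<longrightarrow> w \<xi> * f k \<xi> = 0"
      by (intro set_integral_nonneg_eq_0_AE)
    then show "AE \<xi> in M. \<xi> \<in> I \<longrightarrow> f k \<xi> = 0"
      using w by (elim AE_mp) (force intro!: AE_I2)
  next
    assume "AE \<xi> in M. \<xi> \<in> I \<longrightarrow> f k \<xi> = 0"
    then have "AE \<xi> in M. indicator I \<xi> *\<^sub>R (w \<xi> * f k \<xi>) = 0"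
      by (elim AE_mp) (auto intro!: AE_I2 simp: indicator_def)
    then show "(LINT \<xi>:I|M. w \<xi> * f k \<xi>) = 0"
      unfolding set_lebesgue_integral_def by (rule integral_eq_zero_AE)
  qed
  show "0 \<le> (\<Sum>k=1..d. A k * (LINT \<xi>:I|M. w \<xi> * f k \<xi>))" using I_nn by (rule sum_nonneg)
  have "(\<Sum>k=1..d. A k * (LINT \<xi>:I|M. w \<xi> * f k \<xi>)) = 0 \<longleftrightarrow>
      (\<forall>k\<in>{1..d}. A k * (LINT \<xi>:I|M. w \<xi> * f k \<xi>) = 0)"
    using I_nn by (intro sum_nonneg_eq_0_iff) auto
  also have "\<dots> \<longleftrightarrow> (\<forall>k\<in>{1..d}. AE \<xi> in M. \<xi> \<in> I \<longrightarrow> f k \<xi> = 0)"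
    by (intro ball_cong refl) (use A I_0 in \<open>simp add: less_imp_neq[symmetric]\<close>)
  finally show "(\<Sum>k=1..d. A k * (LINT \<xi>:I|M. w \<xi> * f k \<xi>)) = 0 \<longleftrightarrow>
      (\<forall>k\<in>{1..d}. AE \<xi> in M. \<xi> \<in> I \<longrightarrow> f k \<xi> = 0)" .
qed

(* r is the relative entropy of h with respect to M, or the placeholder 1 if that is infinite. *)
lemma entropy_relative_to_maxwellian:
  assumes \<rho>: "0 < \<rho>" and \<theta>: "0 < \<theta>" and nn: "\<And>\<xi>. 0 < \<xi> \<Longrightarrow> 0 \<le> h \<xi>"
    and m: "set_integrable lborel {0<..} (\<lambda>\<xi>. \<xi> * h \<xi>)"
    and e: "set_integrable lborel {0<..} (\<lambda>\<xi>. \<xi> ^ 3 * h \<xi>)"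
  defines "a \<equiv> ln (\<rho> / sqrt (2 * pi * \<theta>))"
  obtains r where "0 \<le> r" "r = 0 \<longleftrightarrow> (AE \<xi> in lborel. 0 < \<xi> \<longrightarrow> h \<xi> = maxwellian \<rho> 0 \<theta> \<xi>)"
    "extended_integral lborel {0<..} (\<lambda>\<xi>. \<xi> * (h \<xi> * ln (h \<xi>))) = \<infinity> \<and> r \<noteq> 0 \<or>
     extended_integral lborel {0<..} (\<lambda>\<xi>. \<xi> * (h \<xi> * ln (h \<xi>))) =
       ereal ((a + 1) * (LBINT \<xi>:{0<..}. \<xi> * h \<xi>) - (LBINT \<xi>:{0<..}. \<xi> ^ 3 * h \<xi>) / (2 * \<theta>)
         - \<rho> * sqrt (\<theta> / (2 * pi)) + r)"
proof -
  let ?M = "maxwellian \<rho> 0 \<theta>"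
  let ?f = "\<lambda>\<xi>. \<xi> * (h \<xi> * ln (h \<xi>))"
  let ?l = "\<lambda>\<xi>. \<xi> * (h \<xi> * ln (?M \<xi>) + h \<xi> - ?M \<xi>)"
  let ?E = "extended_integral lborel {0<..} ?f"
  let ?eq = "AE \<xi> in lborel. 0 < \<xi> \<longrightarrow> h \<xi> = ?M \<xi>"
  let ?c = "(a + 1) * (LBINT \<xi>:{0<..}. \<xi> * h \<xi>) - (LBINT \<xi>:{0<..}. \<xi> ^ 3 * h \<xi>) / (2 * \<theta>)
         - \<rho> * sqrt (\<theta> / (2 * pi))"
  \<comment> \<open>\<open>?l\<close> is the Gibbs lower bound for the entropy density
    \<open>?f\<close>. As \<open>ln ?M\<close> is affine in the square of \<xi>, it becomes a linear
    combination of the mass and energy densities of \<open>h\<close> and the mass density of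
    \<open>?M\<close>.\<close>
  have l_eq: "?l = (\<lambda>\<xi>. (a + 1) * (\<xi> * h \<xi>) - (\<xi> ^ 3 * h \<xi>) / (2 * \<theta>) - \<xi> * ?M \<xi>)"
    unfolding ln_maxwellian[OF \<rho> \<theta>] a_def
    by (simp add: fun_eq_iff algebra_simps power2_eq_square power3_eq_cube)
  have i1: "set_integrable lborel {0<..} (\<lambda>\<xi>. (a + 1) * (\<xi> * h \<xi>))"
    and i2: "set_integrable lborel {0<..} (\<lambda>\<xi>. (\<xi> ^ 3 * h \<xi>) / (2 * \<theta>))"
    using m e by simp_all
  note i3 = maxwellian_mass_integrable[OF \<theta>, of \<rho>]
  have l: "set_integrable lborel {0<..} ?l"
    unfolding l_eq by (intro set_integral_diff i1 i2 i3)
  have l_int: "(LBINT \<xi>:{0<..}. ?l \<xi>) = ?c"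
    unfolding l_eq by (simp add: set_integral_diff i1 i2 i3 maxwellian_mass[OF \<theta>])
  have le: "?l \<xi> \<le> ?f \<xi>" if "\<xi> \<in> {0<..}" for \<xi>
    using that gibbs_pointwise(1)[OF nn maxwellian_pos[OF \<rho> \<theta>]] by (intro mult_left_mono) auto
  \<comment> \<open>Only \<xi> * \<open>h\<close> is known to be measurable; dividing by \<xi>
    recovers \<open>h\<close> on the positive half-line, and at 0 both sides are 0.\<close>
  have H: "(\<lambda>\<xi>. indicator {0<..} \<xi> * h \<xi>) \<in> borel_measurable lborel"
  proof -
    have "(\<lambda>\<xi>. indicator {0<..} \<xi> *\<^sub>R (\<xi> * h \<xi>)) \<in> borel_measurable lborel"
      using m unfolding set_integrable_def by (rule borel_measurable_integrable)
    then have "(\<lambda>\<xi>. (indicator {0<..} \<xi> *\<^sub>R (\<xi> * h \<xi>)) / \<xi>) \<in> borel_measurable lborel"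
      by measurable
    also have "(\<lambda>\<xi>. (indicator {0<..} \<xi> *\<^sub>R (\<xi> * h \<xi>)) / \<xi>) = (\<lambda>\<xi>. indicator {0<..} \<xi> * h \<xi>)"
      by (auto simp: indicator_def)
    finally show ?thesis .
  qed
  have f: "set_borel_measurable lborel {0<..} ?f"
  proof -
    \<comment> \<open>The cut-off may be moved inside the logarithm: off the half-line the factor in
      front of \<open>ln\<close> is already 0.\<close>
    have "(\<lambda>\<xi>. \<xi> * ((indicator {0<..} \<xi> * h \<xi>) * ln (indicator {0<..} \<xi> * h \<xi>)))
        \<in> borel_measurable lborel"
      using H by measurable
    also have "(\<lambda>\<xi>. \<xi> * ((indicator {0<..} \<xi> * h \<xi>) * ln (indicator {0<..} \<xi> * h \<xi>)))
        = (\<lambda>\<xi>. indicator {0<..} \<xi> *\<^sub>R ?f \<xi>)"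
      by (auto simp: indicator_def)
    finally show ?thesis by (simp add: set_borel_measurable_def)
  qed
  have eq_iff: "?f \<xi> - ?l \<xi> = 0 \<longleftrightarrow> h \<xi> = ?M \<xi>" if "0 < \<xi>" for \<xi>
    using that gibbs_pointwise(2)[OF nn maxwellian_pos[OF \<rho> \<theta>]] by simp
  \<comment> \<open>If \<open>h\<close> equals the Maxwellian almost everywhere, \<open>?f\<close>
    agrees with the integrable \<open>?l\<close>. An infinite entropy therefore excludes equality,
    which is why a nonzero \<open>r\<close> is the right choice in that case.\<close>
  have eq_f: "set_integrable lborel {0<..} ?f" if "?eq"
  proof -
    have "AE \<xi> in lborel. \<xi> \<in> {0<..} \<longrightarrow> ?l \<xi> = ?f \<xi>"
      using that eq_iff by (elim AE_mp) (auto intro!: AE_I2)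
    then have "AE \<xi> in lborel. indicator {0<..} \<xi> *\<^sub>R ?l \<xi> = indicator {0<..} \<xi> *\<^sub>R ?f \<xi>"
      by (elim AE_mp) (auto intro!: AE_I2 simp: indicator_def)
    then show ?thesis
      using l f unfolding set_integrable_def set_borel_measurable_def
      by (subst integrable_cong_AE[symmetric]) auto
  qed
  have E: "?E = (if set_integrable lborel {0<..} ?f then ereal (LBINT \<xi>:{0<..}. ?f \<xi>) else \<infinity>)"
    using f l le by (rule extended_integral_lower_bounded)
  show thesis
  proof (cases "set_integrable lborel {0<..} ?f")
    case True
    let ?r = "LBINT \<xi>:{0<..}. ?f \<xi> - ?l \<xi>"
    have i: "set_integrable lborel {0<..} (\<lambda>\<xi>. ?f \<xi> - ?l \<xi>)"
      using True l by (intro set_integral_diff) auto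
    have "?r = (LBINT \<xi>:{0<..}. ?f \<xi>) - ?c" using True l by (simp add: set_integral_diff l_int)
    moreover have "0 \<le> ?r"
      unfolding set_lebesgue_integral_def using le
      by (intro integral_nonneg_AE AE_I2) (auto simp: indicator_def)
    moreover have "?r = 0 \<longleftrightarrow> ?eq"
    proof
      assume "?r = 0"
      then have "AE \<xi> in lborel. \<xi> \<in> {0<..} \<longrightarrow> ?f \<xi> - ?l \<xi> = 0"
        using i le by (intro set_integral_nonneg_eq_0_AE) auto
      then show ?eq using eq_iff by (elim AE_mp) (auto intro!: AE_I2)
    next
      assume ?eq
      then have "AE \<xi> in lborel. indicator {0<..} \<xi> *\<^sub>R (?f \<xi> - ?l \<xi>) = 0"
        using eq_iff by (elim AE_mp) (auto intro!: AE_I2 simp: indicator_def)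
      then show "?r = 0"
        unfolding set_lebesgue_integral_def by (rule integral_eq_zero_AE)
    qed
    ultimately show thesis using E True by (intro that[of ?r]) auto
  next
    case False
    with E eq_f have "?E = \<infinity>" "\<not> ?eq" by auto
    then show thesis by (intro that[of 1]) auto
  qed
qed


section \<open>Minimality of the Maxwellian at prescribed fluxes\<close>

text \<open>For positive \<open>\<rho>\<close> the entropy flux of \<open>h\<close>, if finite,
  exceeds that of the Maxwellian by the weighted sum of the relative entropies. The second
  conclusion starts from the reverse inequality, the form in which a competing minimiser
  enters.\<close>

lemma entropy_flux_maxwellian_le:
  assumes A: "\<And>k. k \<in> {1..d} \<Longrightarrow> 0 < A k" and \<rho>: "0 \<le> \<rho>" and \<theta>: "0 < \<theta>"
    and nn: "\<And>k \<xi>. k \<in> {1..d} \<Longrightarrow> 0 < \<xi> \<Longrightarrow> 0 \<le> h k \<xi>"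
    and m: "\<And>k. k \<in> {1..d} \<Longrightarrow> set_integrable lborel {0<..} (\<lambda>\<xi>. \<xi> * h k \<xi>)"
    and e: "\<And>k. k \<in> {1..d} \<Longrightarrow> set_integrable lborel {0<..} (\<lambda>\<xi>. \<xi> ^ 3 * h k \<xi>)"
    and mass: "(\<Sum>k=1..d. A k * (LBINT \<xi>:{0<..}. \<xi> * h k \<xi>)) =
      (\<Sum>k=1..d. A k * (LBINT \<xi>:{0<..}. \<xi> * maxwellian \<rho> 0 \<theta> \<xi>))"
    and energy: "(\<Sum>k=1..d. A k * (LBINT \<xi>:{0<..}. \<xi> ^ 3 * h k \<xi>)) =
      (\<Sum>k=1..d. A k * (LBINT \<xi>:{0<..}. \<xi> ^ 3 * maxwellian \<rho> 0 \<theta> \<xi>))"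
  shows "entropy_flux d A (\<lambda>k. maxwellian \<rho> 0 \<theta>) \<le> entropy_flux d A h"
    and "entropy_flux d A h \<le> entropy_flux d A (\<lambda>k. maxwellian \<rho> 0 \<theta>) \<Longrightarrow> k \<in> {1..d} \<Longrightarrow>
      AE \<xi> in lborel. 0 < \<xi> \<longrightarrow> h k \<xi> = maxwellian \<rho> 0 \<theta> \<xi>"
proof -
  let ?M = "maxwellian \<rho> 0 \<theta>"
  let ?eq = "\<lambda>k. AE \<xi> in lborel. 0 < \<xi> \<longrightarrow> h k \<xi> = ?M \<xi>"
  have *: "entropy_flux d A (\<lambda>k. ?M) \<le> entropy_flux d A h \<and>
    (entropy_flux d A h \<le> entropy_flux d A (\<lambda>k. ?M) \<longrightarrow> (\<forall>k\<in>{1..d}. ?eq k))"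
  proof (cases "\<rho> = 0")
    case True
    have "(\<Sum>k=1..d. A k * (LBINT \<xi>:{0<..}. \<xi> * h k \<xi>)) = 0"
      unfolding mass maxwellian_mass[OF \<theta>] using True by simp
    then have eq: "?eq k" if "k \<in> {1..d}" for k
      using sum_weighted_integrals_nonneg(2)[of d A lborel "{0<..}" "\<lambda>\<xi>. \<xi>" h] A m nn that True
      by simp
    have "entropy_flux d A h = entropy_flux d A (\<lambda>k. ?M)"
      unfolding entropy_flux_def
    proof (intro sum.cong refl arg_cong2[where f = "(*)"] extended_integral_cong_AE)
      fix k assume "k \<in> {1..d}"
      from eq[OF this] show "AE \<xi> in lborel. \<xi> \<in> {0<..} \<longrightarrow>
          \<xi> * (h k \<xi> * ln (h k \<xi>)) = \<xi> * (?M \<xi> * ln (?M \<xi>))"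
        by (elim AE_mp) (auto intro!: AE_I2)
    qed
    with eq show ?thesis by simp
  next
    case False
    with \<rho> have \<rho>: "0 < \<rho>" by simp
    define a where "a = ln (\<rho> / sqrt (2 * pi * \<theta>))"
    define c where "c f = (a + 1) * (LBINT \<xi>:{0<..}. \<xi> * f \<xi>)
        - (LBINT \<xi>:{0<..}. \<xi> ^ 3 * f \<xi>) / (2 * \<theta>) - \<rho> * sqrt (\<theta> / (2 * pi))" for f :: "real \<Rightarrow> real"
    define E where "E f = extended_integral lborel {0<..} (\<lambda>\<xi>. \<xi> * (f \<xi> * ln (f \<xi>)))"
      for f :: "real \<Rightarrow> real"
    \<comment> \<open>The Maxwellian compared with itself has \<open>r = 0\<close>, which excludes
      the infinite alternative.\<close>
    have EM: "E ?M = ereal (c ?M)"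
    proof (rule entropy_relative_to_maxwellian[OF \<rho> \<theta>, of ?M])
      fix r :: real
      assume "r = 0 \<longleftrightarrow> (AE \<xi> in lborel. 0 < \<xi> \<longrightarrow> ?M \<xi> = ?M \<xi>)"
      then have "r = 0" by simp
      moreover assume "extended_integral lborel {0<..} (\<lambda>\<xi>. \<xi> * (?M \<xi> * ln (?M \<xi>))) = \<infinity> \<and> r \<noteq> 0 \<or>
        extended_integral lborel {0<..} (\<lambda>\<xi>. \<xi> * (?M \<xi> * ln (?M \<xi>))) =
          ereal ((ln (\<rho> / sqrt (2 * pi * \<theta>)) + 1) * (LBINT \<xi>:{0<..}. \<xi> * ?M \<xi>)
            - (LBINT \<xi>:{0<..}. \<xi> ^ 3 * ?M \<xi>) / (2 * \<theta>) - \<rho> * sqrt (\<theta> / (2 * pi)) + r)"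
      ultimately show ?thesis unfolding E_def c_def a_def by simp
    qed (use \<rho> \<theta> in \<open>simp_all add: maxwellian_nonneg maxwellian_mass_integrable maxwellian_energy_integrable\<close>)
    have "\<forall>k\<in>{1..d}. \<exists>r. 0 \<le> r \<and> (r = 0 \<longleftrightarrow> ?eq k) \<and> (E (h k) = \<infinity> \<or> E (h k) = ereal (c (h k) + r))"
    proof
      fix k assume k: "k \<in> {1..d}"
      show "\<exists>r. 0 \<le> r \<and> (r = 0 \<longleftrightarrow> ?eq k) \<and> (E (h k) = \<infinity> \<or> E (h k) = ereal (c (h k) + r))"
        by (rule entropy_relative_to_maxwellian[OF \<rho> \<theta> nn[OF k] m[OF k] e[OF k]])
          (unfold E_def c_def a_def, blast+)
    qed
    from bchoice[OF this] obtain r where "\<forall>k\<in>{1..d}.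
        0 \<le> r k \<and> (r k = 0 \<longleftrightarrow> ?eq k) \<and> (E (h k) = \<infinity> \<or> E (h k) = ereal (c (h k) + r k))" ..
    then have r: "0 \<le> r k" "r k = 0 \<longleftrightarrow> ?eq k" "E (h k) = \<infinity> \<or> E (h k) = ereal (c (h k) + r k)"
      if "k \<in> {1..d}" for k
      using that by blast+
    have c_sum: "(\<Sum>k=1..d. A k * c (f k)) =
        (a + 1) * (\<Sum>k=1..d. A k * (LBINT \<xi>:{0<..}. \<xi> * f k \<xi>))
        - (\<Sum>k=1..d. A k * (LBINT \<xi>:{0<..}. \<xi> ^ 3 * f k \<xi>)) / (2 * \<theta>)
        - (\<Sum>k=1..d. A k) * (\<rho> * sqrt (\<theta> / (2 * pi)))" for f :: "nat \<Rightarrow> real \<Rightarrow> real"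
      unfolding c_def sum_distrib_left sum_distrib_right sum_divide_distrib sum_subtractf[symmetric]
      by (intro sum.cong refl) (simp add: algebra_simps)
    \<comment> \<open>The individual \<open>c (h k)\<close> may differ from \<open>c ?M\<close>;
      only the sums weighted by the areas agree, since the constraints couple all pipelines.\<close>
    have c_eq: "(\<Sum>k=1..d. A k * c (h k)) = (\<Sum>k=1..d. A k * c ?M)"
      unfolding c_sum[of h] c_sum[of "\<lambda>k. ?M"] mass energy ..
    have FM: "entropy_flux d A (\<lambda>k. ?M) = ereal (\<Sum>k=1..d. A k * c ?M)"
      unfolding entropy_flux_def E_def[symmetric] EM by simp
    have "entropy_flux d A h = \<infinity> \<or> entropy_flux d A h = ereal (\<Sum>k=1..d. A k * (c (h k) + r k))"
      unfolding entropy_flux_def E_def[symmetric]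
      using sum_ereal_finite_or_infinite[of "{1..d}" A "\<lambda>k. E (h k)" "\<lambda>k. c (h k) + r k"] A r(3)
      by blast
    then have F: "entropy_flux d A h = \<infinity> \<or>
        entropy_flux d A h = ereal ((\<Sum>k=1..d. A k * c ?M) + (\<Sum>k=1..d. A k * r k))"
      unfolding distrib_left sum.distrib c_eq .
    have Ar: "0 \<le> A k * r k" if "k \<in> {1..d}" for k
      using A[OF that] r(1)[OF that] by simp
    then have nn_sum: "0 \<le> (\<Sum>k=1..d. A k * r k)" by (rule sum_nonneg)
    have "?eq k" if le: "entropy_flux d A h \<le> entropy_flux d A (\<lambda>k. ?M)" and k: "k \<in> {1..d}" for k
    proof -
      \<comment> \<open>The flux of the Maxwellian is finite, so the assumed inequality rules out
        the infinite alternative and leaves a nonnegative sum that is at most 0.\<close>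
      have "(\<Sum>k=1..d. A k * r k) = 0" using F le nn_sum unfolding FM by auto
      then have "A k * r k = 0" using k Ar by (subst (asm) sum_nonneg_eq_0_iff) auto
      then show ?thesis using A[OF k] r(2)[OF k] by simp
    qed
    moreover have "entropy_flux d A (\<lambda>k. ?M) \<le> entropy_flux d A h"
      using F nn_sum unfolding FM by auto
    ultimately show ?thesis by blast
  qed
  then show "entropy_flux d A (\<lambda>k. ?M) \<le> entropy_flux d A h"
    and "entropy_flux d A h \<le> entropy_flux d A (\<lambda>k. ?M) \<Longrightarrow> k \<in> {1..d} \<Longrightarrow> ?eq k"
    by auto
qed

section \<open>Transfer from \<mu> to the Lebesgue measure\<close>

lemma kinetic_measure_AE_iff:
  assumes "kinetic_measure \<mu>"
  shows "(AE x in \<mu>. P x) \<longleftrightarrow> (AE x in lborel. P x)"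
proof -
  have "sets \<mu> = sets lborel" "null_sets \<mu> = null_sets lborel"
    using assms by (auto simp: kinetic_measure_def)
  moreover from this(1) have "space \<mu> = space lborel" by (rule sets_eq_imp_space_eq)
  ultimately show ?thesis by (simp add: eventually_ae_filter)
qed

lemma L1_nonneg_flux_integrable:
  assumes "kinetic_measure \<mu>" "f \<in> L1_nonneg \<mu> I"
  shows "set_integrable lborel I (\<lambda>\<xi>. \<xi> * f \<xi>)" "set_integrable lborel I (\<lambda>\<xi>. \<xi> ^ 3 * f \<xi>)"
proof -
  have "integrable \<mu> (\<lambda>\<xi>. indicator I \<xi> *\<^sub>R f \<xi>)"
    using assms(2) by (simp add: L1_nonneg_def set_integrable_def)
  then have "integrable lborel (\<lambda>\<xi>. \<xi> * (indicator I \<xi> *\<^sub>R f \<xi>))"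
    "integrable lborel (\<lambda>\<xi>. \<xi> ^ 3 * (indicator I \<xi> *\<^sub>R f \<xi>))"
    using assms(1) by (auto simp only: kinetic_measure_def)
  then show "set_integrable lborel I (\<lambda>\<xi>. \<xi> * f \<xi>)" "set_integrable lborel I (\<lambda>\<xi>. \<xi> ^ 3 * f \<xi>)"
    by (simp_all add: set_integrable_def mult.left_commute)
qed

lemma set_integral_cong_AE_integrable:
  fixes f g :: "'a \<Rightarrow> real"
  assumes "set_integrable M I f" "set_integrable M I g" "AE x in M. x \<in> I \<longrightarrow> f x = g x"
  shows "(LINT x:I|M. f x) = (LINT x:I|M. g x)"
  unfolding set_lebesgue_integral_def
proof (rule integral_cong_AE)
  show "AE x in M. indicator I x *\<^sub>R f x = indicator I x *\<^sub>R g x"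
    using assms(3) by (elim AE_mp) (auto intro!: AE_I2 simp: indicator_def)
qed (use assms(1,2) in \<open>simp_all add: set_integrable_def borel_measurable_integrable\<close>)

section \<open>Incoming fluxes and the Maxwellian parameters\<close>

text \<open>The sign makes the weight positive on negative velocities, so that conservation reads
  outgoing flux equals incoming flux, with both sides nonnegative for admissible data.\<close>

definition incoming_mass :: "nat \<Rightarrow> (nat \<Rightarrow> real) \<Rightarrow> (nat \<Rightarrow> real \<Rightarrow> real) \<Rightarrow> real" where
  "incoming_mass d A g = (\<Sum>k=1..d. A k * (LBINT \<xi>:{..<0}. - \<xi> * g k \<xi>))"

definition incoming_energy :: "nat \<Rightarrow> (nat \<Rightarrow> real) \<Rightarrow> (nat \<Rightarrow> real \<Rightarrow> real) \<Rightarrow> real" where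
  "incoming_energy d A g = (\<Sum>k=1..d. A k * (LBINT \<xi>:{..<0}. - (\<xi> ^ 3) * g k \<xi>))"

lemma conserves_mass_iff:
  "conserves_mass d A g h \<longleftrightarrow>
     (\<Sum>k=1..d. A k * (LBINT \<xi>:{0<..}. \<xi> * h k \<xi>)) = incoming_mass d A g"
  by (auto simp: conserves_mass_def incoming_mass_def distrib_left sum.distrib sum_negf
      set_lebesgue_integral_def)

lemma conserves_energy_iff:
  "conserves_energy d A g h \<longleftrightarrow>
     (\<Sum>k=1..d. A k * (LBINT \<xi>:{0<..}. \<xi> ^ 3 * h k \<xi>)) = incoming_energy d A g"
  by (auto simp: conserves_energy_def incoming_energy_def distrib_left sum.distrib sum_negf
      set_lebesgue_integral_def)

text \<open>The energy flux of a centred Maxwellian is \<open>2 * \<theta>\<close> times its mass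
  flux. Inserting the mass equation removes \<open>\<rho>\<close> from the energy equation, so the
  system is triangular: first \<theta>, then \<rho>.\<close>

lemma maxwellian_parameters_iff:
  "maxwellian_parameters d A g \<rho> \<theta> \<longleftrightarrow> 0 \<le> \<rho> \<and> 0 < \<theta> \<and>
     (\<Sum>k=1..d. A k) * (\<rho> * sqrt (\<theta> / (2 * pi))) = incoming_mass d A g \<and>
     incoming_energy d A g = 2 * \<theta> * incoming_mass d A g"
  unfolding maxwellian_parameters_def conserves_mass_iff conserves_energy_iff
proof (intro conj_cong refl)
  assume \<theta>: "0 < \<theta>"
  let ?q = "(\<Sum>k=1..d. A k) * (\<rho> * sqrt (\<theta> / (2 * pi)))"
  show "(\<Sum>k=1..d. A k * (LBINT \<xi>:{0<..}. \<xi> * maxwellian \<rho> 0 \<theta> \<xi>)) = incoming_mass d A g \<longleftrightarrow>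
      ?q = incoming_mass d A g"
    by (simp add: maxwellian_mass[OF \<theta>] sum_distrib_right)
  have "(\<Sum>k=1..d. A k * (LBINT \<xi>:{0<..}. \<xi> ^ 3 * maxwellian \<rho> 0 \<theta> \<xi>)) = 2 * \<theta> * ?q"
    by (simp add: maxwellian_energy[OF \<theta>] flip: sum_distrib_right)
  moreover assume "?q = incoming_mass d A g"
  ultimately show "(\<Sum>k=1..d. A k * (LBINT \<xi>:{0<..}. \<xi> ^ 3 * maxwellian \<rho> 0 \<theta> \<xi>)) = incoming_energy d A g \<longleftrightarrow>
      incoming_energy d A g = 2 * \<theta> * incoming_mass d A g"
    by auto
qed

lemma incoming_ae_cong:
  assumes "kinetic_measure \<mu>" "g \<in> L1_tuple \<mu> d {..<0}" "g' \<in> L1_tuple \<mu> d {..<0}"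
    and eq: "ae_eq_tuple \<mu> d {..<0} g g'"
  shows "incoming_mass d A g = incoming_mass d A g'"
    and "incoming_energy d A g = incoming_energy d A g'"
proof -
  have L1: "g k \<in> L1_nonneg \<mu> {..<0}" "g' k \<in> L1_nonneg \<mu> {..<0}" if "k \<in> {1..d}" for k
    using assms(2,3) that by (auto simp: L1_tuple_def)
  have AE: "AE \<xi> in lborel. \<xi> \<in> {..<0} \<longrightarrow> w \<xi> * g k \<xi> = w \<xi> * g' k \<xi>"
    if "k \<in> {1..d}" for k and w :: "real \<Rightarrow> real"
  proof -
    have "AE \<xi> in lborel. \<xi> \<in> {..<0} \<longrightarrow> g k \<xi> = g' k \<xi>"
      using eq that unfolding ae_eq_tuple_def kinetic_measure_AE_iff[OF assms(1)] by blast
    then show ?thesis by (elim AE_mp) (auto intro!: AE_I2)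
  qed
  show "incoming_mass d A g = incoming_mass d A g'"
    unfolding incoming_mass_def
    using L1_nonneg_flux_integrable(1)[OF assms(1) L1(1)] L1_nonneg_flux_integrable(1)[OF assms(1) L1(2)]
    by (intro sum.cong refl arg_cong2[where f = "(*)"] set_integral_cong_AE_integrable AE)
      (auto simp: set_integrable_def)
  show "incoming_energy d A g = incoming_energy d A g'"
    unfolding incoming_energy_def
    using L1_nonneg_flux_integrable(2)[OF assms(1) L1(1)] L1_nonneg_flux_integrable(2)[OF assms(1) L1(2)]
    by (intro sum.cong refl arg_cong2[where f = "(*)"] set_integral_cong_AE_integrable AE)
      (auto simp: set_integrable_def)
qed

lemma maxwellian_parameters_exist:
  assumes A: "\<And>k. k \<in> {1..d} \<Longrightarrow> 0 < A k" and \<mu>: "kinetic_measure \<mu>"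
    and g: "g \<in> L1_tuple \<mu> d {..<0}"
  shows "\<exists>\<rho> \<theta>. maxwellian_parameters d A g \<rho> \<theta>"
proof -
  have L1: "g k \<in> L1_nonneg \<mu> {..<0}" if "k \<in> {1..d}" for k
    using g that by (auto simp: L1_tuple_def)
  have nn: "0 \<le> g k \<xi>" if "k \<in> {1..d}" "\<xi> \<in> {..<0}" for k \<xi>
    using L1[OF that(1)] that(2) by (auto simp: L1_nonneg_def)
  have w3: "0 < - (\<xi> ^ 3)" if "\<xi> \<in> {..<0}" for \<xi> :: real
    using that by (simp add: power_less_zero_eq)
  have i1: "set_integrable lborel {..<0} (\<lambda>\<xi>. - \<xi> * g k \<xi>)"
    and i3: "set_integrable lborel {..<0} (\<lambda>\<xi>. - (\<xi> ^ 3) * g k \<xi>)" if "k \<in> {1..d}" for k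
    using L1_nonneg_flux_integrable[OF \<mu> L1[OF that]] by (simp_all add: set_integrable_def)
  let ?m = "incoming_mass d A g" and ?e = "incoming_energy d A g"
  note m = sum_weighted_integrals_nonneg[where I = "{..<0}" and f = g and M = lborel and d = d and A = A
      and w = uminus, OF A i1 nn, folded incoming_mass_def, simplified]
  note e = sum_weighted_integrals_nonneg[where I = "{..<0}" and f = g and M = lborel and d = d and A = A
      and w = "\<lambda>\<xi>. - (\<xi> ^ 3)", OF A i3 nn w3, folded incoming_energy_def]
  \<comment> \<open>Each flux vanishes exactly if every \<open>g k\<close> is zero almost everywhere
    on the negative half-line, hence they vanish together.\<close>
  have m_nn: "0 \<le> ?m" and e_nn: "0 \<le> ?e" and zero: "?m = 0 \<longleftrightarrow> ?e = 0"
    using m e by auto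
  show ?thesis
  proof (cases "?m = 0")
    case True
    \<comment> \<open>With \<open>\<rho> = 0\<close> both equations hold for every positive
      temperature; 1 is an arbitrary choice.\<close>
    with zero show ?thesis
      by (intro exI[of _ 0] exI[of _ 1]) (simp add: maxwellian_parameters_iff)
  next
    case False
    with m_nn e_nn zero have pos: "0 < ?m" "0 < ?e" by auto
    define \<theta> where "\<theta> = ?e / (2 * ?m)"
    have \<theta>: "0 < \<theta>" using pos by (simp add: \<theta>_def)
    \<comment> \<open>A nonzero mass flux requires at least one pipeline, so the total area in the
      denominator of \<open>\<rho>\<close> is positive.\<close>
    have "{1..d} \<noteq> {}" using False unfolding incoming_mass_def by (metis sum.empty)
    then have S: "0 < (\<Sum>k=1..d. A k)" using A by (intro sum_pos) auto
    define \<rho> where "\<rho> = ?m / ((\<Sum>k=1..d. A k) * sqrt (\<theta> / (2 * pi)))"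
    have q: "0 < sqrt (\<theta> / (2 * pi))" using \<theta> by simp
    have "0 \<le> \<rho>" using S q pos unfolding \<rho>_def by (intro divide_nonneg_nonneg) auto
    moreover have "(\<Sum>k=1..d. A k) * (\<rho> * sqrt (\<theta> / (2 * pi))) = ?m"
      unfolding \<rho>_def using S \<theta> by simp
    moreover have "?e = 2 * \<theta> * ?m" using pos by (simp add: \<theta>_def)
    ultimately show ?thesis using \<theta> by (auto simp: maxwellian_parameters_iff)
  qed
qed

text \<open>The function is unique although the parameters need not be: if
  \<open>\<rho> = 0\<close>, the temperature is free. Otherwise the incoming mass is nonzero and can
  be cancelled from the energy equation.\<close>

lemma maxwellian_parameters_unique:
  assumes "0 < (\<Sum>k=1..d. A k)"
    and p: "maxwellian_parameters d A g \<rho> \<theta>" and p': "maxwellian_parameters d A g' \<rho>' \<theta>'"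
    and m: "incoming_mass d A g = incoming_mass d A g'"
    and e: "incoming_energy d A g = incoming_energy d A g'"
  shows "maxwellian \<rho> 0 \<theta> = maxwellian \<rho>' 0 \<theta>'"
proof -
  have pos: "0 < \<theta>" "0 < \<theta>'" using p p' by (auto simp: maxwellian_parameters_iff)
  have q: "\<rho> * sqrt (\<theta> / (2 * pi)) = \<rho>' * sqrt (\<theta>' / (2 * pi))"
    using p p' m assms(1) unfolding maxwellian_parameters_iff by (metis less_irrefl mult_cancel_left)
  show ?thesis
  proof (cases "\<rho> = 0")
    case True
    with q pos have "\<rho>' = 0" by auto
    with True show ?thesis by (simp add: fun_eq_iff)
  next
    case False
    then have "incoming_mass d A g \<noteq> 0"
      using p pos assms(1) by (auto simp: maxwellian_parameters_iff)
    moreover have "2 * \<theta> * incoming_mass d A g = 2 * \<theta>' * incoming_mass d A g"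
      using p p' m e by (simp add: maxwellian_parameters_iff)
    ultimately have "\<theta> = \<theta>'" by simp
    with q pos show ?thesis by simp
  qed
qed

section \<open>Admissibility of the Maxwellian coupling and conclusion\<close>

text \<open>The point to check is compatibility with equality almost everywhere. The parameter
  choices may differ for equivalent data, but the incoming fluxes agree, and they determine the
  Maxwellian.\<close>

lemma kinetic_coupling_maxwellian:
  assumes A: "\<And>k. k \<in> {1..d} \<Longrightarrow> 0 < A k" and \<mu>: "kinetic_measure \<mu>"
    and par: "\<forall>g\<in>L1_tuple \<mu> d {..<0}. maxwellian_parameters d A g (\<rho> g) (\<theta> g)"
  shows "kinetic_coupling \<mu> d A (\<lambda>g k. maxwellian (\<rho> g) 0 (\<theta> g))"
  unfolding kinetic_coupling_def
proof (intro conjI ballI impI funcsetI)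
  fix g assume "g \<in> L1_tuple \<mu> d {..<0}"
  with par have "maxwellian_parameters d A g (\<rho> g) (\<theta> g)" by blast
  then show "conserves_mass d A g (\<lambda>k. maxwellian (\<rho> g) 0 (\<theta> g))"
    "conserves_energy d A g (\<lambda>k. maxwellian (\<rho> g) 0 (\<theta> g))"
    "(\<lambda>k. maxwellian (\<rho> g) 0 (\<theta> g)) \<in> L1_tuple \<mu> d {0<..}"
    using \<mu> by (auto simp: maxwellian_parameters_def L1_tuple_def L1_nonneg_def kinetic_measure_def
        maxwellian_nonneg)
next
  fix g g'
  assume g: "g \<in> L1_tuple \<mu> d {..<0}" "g' \<in> L1_tuple \<mu> d {..<0}" "ae_eq_tuple \<mu> d {..<0} g g'"
  show "ae_eq_tuple \<mu> d {0<..} (\<lambda>k. maxwellian (\<rho> g) 0 (\<theta> g)) (\<lambda>k. maxwellian (\<rho> g') 0 (\<theta> g'))"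
  \<comment> \<open>For \<open>d = 0\<close> the total area is 0 and the Maxwellians may differ, but
    there is no component to compare.\<close>
  proof (cases "{1..d} = {}")
    case False
    then have "0 < (\<Sum>k=1..d. A k)" using A by (intro sum_pos) auto
    then have "maxwellian (\<rho> g) 0 (\<theta> g) = maxwellian (\<rho> g') 0 (\<theta> g')"
      using par g(1,2) incoming_ae_cong[OF \<mu> g] by (blast intro: maxwellian_parameters_unique)
    then show ?thesis by (simp add: ae_eq_tuple_def)
  qed (simp add: ae_eq_tuple_def)
qed

theorem mainTheorem7:
  fixes \<mu> :: "real measure" and d :: nat and A :: "nat \<Rightarrow> real"
  assumes "\<And>k. k \<in> {1..d} \<Longrightarrow> 0 < A k"
    and "kinetic_measure \<mu>"
  shows "(\<forall>g\<in>L1_tuple \<mu> d {..<0}. \<exists>\<rho> \<theta>. maxwellian_parameters d A g \<rho> \<theta>) \<and>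
    (\<forall>\<rho> \<theta>. (\<forall>g\<in>L1_tuple \<mu> d {..<0}. maxwellian_parameters d A g (\<rho> g) (\<theta> g)) \<longrightarrow>
       unique_entropy_minimizer \<mu> d A (\<lambda>g k \<xi>. maxwellian (\<rho> g) 0 (\<theta> g) \<xi>))"
proof (intro conjI ballI allI impI)
  fix g assume "g \<in> L1_tuple \<mu> d {..<0}"
  with assms show "\<exists>\<rho> \<theta>. maxwellian_parameters d A g \<rho> \<theta>" by (rule maxwellian_parameters_exist)
next
  fix \<rho> \<theta> :: "(nat \<Rightarrow> real \<Rightarrow> real) \<Rightarrow> real"
  let ?\<Psi> = "\<lambda>g (k::nat). maxwellian (\<rho> g) 0 (\<theta> g)"
  assume par: "\<forall>g\<in>L1_tuple \<mu> d {..<0}. maxwellian_parameters d A g (\<rho> g) (\<theta> g)"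
  have coupling: "kinetic_coupling \<mu> d A ?\<Psi>"
    using assms par by (rule kinetic_coupling_maxwellian)
  \<comment> \<open>Minimising over maps reduces to a problem for fixed \<open>g\<close>: of a
    competitor only the value \<open>\<Phi> g\<close> matters, and the constraints give it the same
    weighted mass and energy fluxes as the Maxwellian.\<close>
  have min: "entropy_flux d A (?\<Psi> g) \<le> entropy_flux d A (\<Phi> g)"
    and unique: "entropy_flux d A (\<Phi> g) \<le> entropy_flux d A (?\<Psi> g) \<Longrightarrow>
      ae_eq_tuple \<mu> d {0<..} (\<Phi> g) (?\<Psi> g)"
    if g: "g \<in> L1_tuple \<mu> d {..<0}" and \<Phi>: "kinetic_coupling \<mu> d A \<Phi>" for g \<Phi>
  proof -
    have cons: "conserves_mass d A g (\<Phi> g)" "conserves_energy d A g (\<Phi> g)"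
      using g \<Phi> by (auto simp: kinetic_coupling_def)
    have "\<Phi> g \<in> L1_tuple \<mu> d {0<..}" using g \<Phi> by (auto simp: kinetic_coupling_def)
    then have L1: "\<Phi> g k \<in> L1_nonneg \<mu> {0<..}" if "k \<in> {1..d}" for k
      using that by (auto simp: L1_tuple_def)
    have par_g: "0 \<le> \<rho> g" "0 < \<theta> g" "conserves_mass d A g (?\<Psi> g)" "conserves_energy d A g (?\<Psi> g)"
      using par g by (auto simp: maxwellian_parameters_def)
    have nn: "0 \<le> \<Phi> g k \<xi>" if "k \<in> {1..d}" "0 < \<xi>" for k \<xi>
      using L1[OF that(1)] that(2) by (auto simp: L1_nonneg_def)
    have mass: "(\<Sum>k=1..d. A k * (LBINT \<xi>:{0<..}. \<xi> * \<Phi> g k \<xi>)) =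
        (\<Sum>k=1..d. A k * (LBINT \<xi>:{0<..}. \<xi> * maxwellian (\<rho> g) 0 (\<theta> g) \<xi>))"
      and energy: "(\<Sum>k=1..d. A k * (LBINT \<xi>:{0<..}. \<xi> ^ 3 * \<Phi> g k \<xi>)) =
        (\<Sum>k=1..d. A k * (LBINT \<xi>:{0<..}. \<xi> ^ 3 * maxwellian (\<rho> g) 0 (\<theta> g) \<xi>))"
      using cons par_g(3,4) unfolding conserves_mass_iff conserves_energy_iff by simp_all
    note entropy = entropy_flux_maxwellian_le[of d A "\<rho> g" "\<theta> g" "\<Phi> g", OF assms(1) par_g(1,2) nn
        L1_nonneg_flux_integrable[OF assms(2) L1] mass energy]
    show "entropy_flux d A (?\<Psi> g) \<le> entropy_flux d A (\<Phi> g)" by (rule entropy(1))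
    show "ae_eq_tuple \<mu> d {0<..} (\<Phi> g) (?\<Psi> g)"
      if "entropy_flux d A (\<Phi> g) \<le> entropy_flux d A (?\<Psi> g)"
      using entropy(2) that
      unfolding ae_eq_tuple_def kinetic_measure_AE_iff[OF assms(2)] by simp
  qed
  show "unique_entropy_minimizer \<mu> d A (\<lambda>g k \<xi>. maxwellian (\<rho> g) 0 (\<theta> g) \<xi>)"
    unfolding unique_entropy_minimizer_def entropy_minimizer_at_def
    \<comment> \<open>Any other minimiser at \<open>g\<close> has entropy flux at most that of the
      Maxwellian coupling, which is itself admissible; this is the premise of
      \<open>unique\<close>.\<close>
    using coupling min unique by blast
qed

end
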